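(* Let $\mathbf{C}$ be a clique-closed subcategory of $\mathbf{S}$. If $\mathbf{C}\cap\mathbf{F}$ has amalgamation, then $\mathbf{C}$ has amalgamation.
   Context: A graph is a finite non-empty set $G$ with a reflexive symmetric relation $\sqcap$ (the edge relation). A relation $R\subseteq H\times G$ between graphs is viewed as a relation from $G$ to $H$; write $R(g)=\{h:(h,g)\in R\}$; $(c,a)\in Q\circ R$ iff $(c,b)\in Q$ and $(b,a)\in R$ for some $b$. $R$ is edge-preserving if $(h,g),(h',g')\in R$ and $g\sqcap g'$ imply $h\sqcap h'$; co-surjective if $R(g)\neq\emptyset$ for all $g\in G$; a function if every $R(g)$ is a singleton. $\mathbf{S}$ is the category of graphs with co-surjective edge-preserving relations as morphisms, and $\mathbf{F}$ is the category of graphs with edge-preserving functions as morphisms; $\mathbf{C}\cap\mathbf{F}$ consists of all objects and morphisms that are both in $\mathbf{C}$ and in $\mathbf{F}$. $\mathbf{C}^H_G$ denotes the set of morphisms of $\mathbf{C}$ from $G$ to $H$. A clique of $G$ is a non-empty subset $C\subseteq G$ with $c\sqcap c'$ for all $c,c'\in C$. The clique graph $\mathsf{X}G$ has the cliques of $G$ as vertices, and two cliques are related by the edge relation iff one is contained in the other. For $R\in\mathbf{S}^H_G$, $\mathsf{X}^R:\mathsf{X}G\to\mathsf{X}H$ is the function $\mathsf{X}^R(C)=\bigcup_{c\in C}R(c)$. Let $\in_G\,\subseteq G\times\mathsf{X}G$ be the membership relation (a relation from $\mathsf{X}G$ to $G$). A subcategory $\mathbf{C}$ of $\mathbf{S}$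 is clique-closed if $\in_G\,\in\mathbf{C}^G_{\mathsf{X}G}$ (in particular $\mathsf{X}G$ is an object of $\mathbf{C}$) for every object $G$ of $\mathbf{C}$, and $\mathsf{X}^R\in\mathbf{C}^{\mathsf{X}H}_{\mathsf{X}G}$ whenever $R\in\mathbf{C}^H_G$. A category $\mathbf{C}$ has amalgamation if for all $R\in\mathbf{C}^G_H$, $Q\in\mathbf{C}^G_I$ there are an object $J$ and $R'\in\mathbf{C}^H_J$, $Q'\in\mathbf{C}^I_J$ with $R\circ R'=Q\circ Q'$. *)

theory Defs
  imports Main "HOL-Library.FSet"
begin

text \<open>
  Vertices are drawn from a universe with arbitrary urelements that contains each of its own finite
  subsets as an element.  In this way the graph of cliques of a graph lives over the same type as the
  graph, so that one category of graphs can contain both.  By foundation, the class of all sets is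
  itself of this form, with the infinite sets in the role of the urelements.
\<close>

datatype 'a univ = Ur 'a | FinSet "'a univ fset"

record 'v graph =
  verts :: "'v set"
  edges :: "('v \<times> 'v) set"

definition is_graph :: "'v graph \<Rightarrow> bool" where
  "is_graph G \<longleftrightarrow> finite (verts G) \<and> verts G \<noteq> {} \<and> edges G \<subseteq> verts G \<times> verts G \<and>
     refl_on (verts G) (edges G) \<and> sym (edges G)"

text \<open>
  A relation \<open>R \<subseteq> verts H \<times> verts G\<close> goes from \<open>G\<close> to \<open>H\<close>, the source being the second component.
  Hence the composite of \<open>Q\<close> after \<open>R\<close> is \<open>Q O R\<close>.
\<close>

definition rel_at :: "('w \<times> 'v) set \<Rightarrow> 'v \<Rightarrow> 'w set" where
  "rel_at R g = {h. (h, g) \<in> R}"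

definition edge_preserving :: "'v graph \<Rightarrow> 'w graph \<Rightarrow> ('w \<times> 'v) set \<Rightarrow> bool" where
  "edge_preserving G H R \<longleftrightarrow>
     (\<forall>h g h' g'. (h, g) \<in> R \<and> (h', g') \<in> R \<and> (g, g') \<in> edges G \<longrightarrow> (h, h') \<in> edges H)"

definition co_surjective :: "'v graph \<Rightarrow> ('w \<times> 'v) set \<Rightarrow> bool" where
  "co_surjective G R \<longleftrightarrow> (\<forall>g\<in>verts G. rel_at R g \<noteq> {})"

definition is_function :: "'v graph \<Rightarrow> ('w \<times> 'v) set \<Rightarrow> bool" where
  "is_function G R \<longleftrightarrow> (\<forall>g\<in>verts G. is_singleton (rel_at R g))"

text \<open>
  \<open>Hom C G H\<close> is the set of morphisms of \<open>C\<close> from \<open>G\<close> to \<open>H\<close>.  Source and target are the indices of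
  the hom-set; the same set of pairs may occur as a morphism between different pairs of graphs.
\<close>

record 'v cat =
  Obj :: "'v graph set"
  Hom :: "'v graph \<Rightarrow> 'v graph \<Rightarrow> ('v \<times> 'v) set set"

definition catS :: "'v cat" where
  "catS = \<lparr>Obj = {G. is_graph G},
           Hom = (\<lambda>G H. {R. is_graph G \<and> is_graph H \<and> R \<subseteq> verts H \<times> verts G \<and>
                            co_surjective G R \<and> edge_preserving G H R})\<rparr>"

definition catF :: "'v cat" where
  "catF = \<lparr>Obj = {G. is_graph G},
           Hom = (\<lambda>G H. {R. is_graph G \<and> is_graph H \<and> R \<subseteq> verts H \<times> verts G \<and>
                            is_function G R \<and> edge_preserving G H R})\<rparr>"

definition cat_inter :: "'v cat \<Rightarrow> 'v cat \<Rightarrow> 'v cat" where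
  "cat_inter C D = \<lparr>Obj = Obj C \<inter> Obj D, Hom = (\<lambda>G H. Hom C G H \<inter> Hom D G H)\<rparr>"

definition subcategory :: "'v cat \<Rightarrow> 'v cat \<Rightarrow> bool" where
  "subcategory C D \<longleftrightarrow>
     Obj C \<subseteq> Obj D \<and>
     (\<forall>G H R. R \<in> Hom C G H \<longrightarrow> G \<in> Obj C \<and> H \<in> Obj C \<and> R \<in> Hom D G H) \<and>
     (\<forall>G\<in>Obj C. Id_on (verts G) \<in> Hom C G G) \<and>
     (\<forall>G H I R Q. R \<in> Hom C G H \<and> Q \<in> Hom C H I \<longrightarrow> Q O R \<in> Hom C G I)"

definition amalgamation :: "'v cat \<Rightarrow> bool" where
  "amalgamation C \<longleftrightarrow>
     (\<forall>G\<in>Obj C. \<forall>H\<in>Obj C. \<forall>I\<in>Obj C. \<forall>R\<in>Hom C H G. \<forall>Q\<in>Hom C I G.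
        \<exists>J\<in>Obj C. \<exists>R'\<in>Hom C J H. \<exists>Q'\<in>Hom C J I. R O R' = Q O Q')"

definition is_clique :: "'v graph \<Rightarrow> 'v fset \<Rightarrow> bool" where
  "is_clique G C \<longleftrightarrow> C \<noteq> {||} \<and> fset C \<subseteq> verts G \<and> (\<forall>c\<in>fset C. \<forall>c'\<in>fset C. (c, c') \<in> edges G)"

definition clique_graph :: "'a univ graph \<Rightarrow> 'a univ graph" where
  "clique_graph G =
     \<lparr>verts = {FinSet C | C. is_clique G C},
      edges = {(FinSet C, FinSet D) | C D.
                 is_clique G C \<and> is_clique G D \<and> (C |\<subseteq>| D \<or> D |\<subseteq>| C)}\<rparr>"

text \<open>The function \<open>C \<mapsto> \<Union>c\<in>C. R(c)\<close> on the cliques of \<open>G\<close>, as a relation.\<close>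

definition clique_map :: "'a univ graph \<Rightarrow> ('a univ \<times> 'a univ) set \<Rightarrow> ('a univ \<times> 'a univ) set" where
  "clique_map G R = {(FinSet D, FinSet C) | C D. is_clique G C \<and> fset D = (\<Union>c\<in>fset C. rel_at R c)}"

definition membership :: "'a univ graph \<Rightarrow> ('a univ \<times> 'a univ) set" where
  "membership G = {(g, FinSet C) | g C. is_clique G C \<and> g \<in> fset C}"

definition clique_closed :: "'a univ cat \<Rightarrow> bool" where
  "clique_closed C \<longleftrightarrow>
     (\<forall>G\<in>Obj C. clique_graph G \<in> Obj C \<and> membership G \<in> Hom C (clique_graph G) G) \<and>
     (\<forall>G\<in>Obj C. \<forall>H\<in>Obj C. \<forall>R\<in>Hom C G H.
        clique_map G R \<in> Hom C (clique_graph G) (clique_graph H))"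

end

theory Submission
  imports Defs
begin

text \<open>
  The membership relations are natural: \<open>R \<circ> \<in>\<^sub>H = \<in>\<^sub>G \<circ> X\<^sup>R\<close> for \<open>R\<close> from \<open>H\<close> to \<open>G\<close>.  Since \<open>X\<^sup>R\<close> and
  \<open>X\<^sup>Q\<close> are functions, they can be amalgamated by functions \<open>R'\<close> and \<open>Q'\<close>, and then
  \<open>\<in>\<^sub>H \<circ> R'\<close> and \<open>\<in>\<^sub>I \<circ> Q'\<close> amalgamate \<open>R\<close> and \<open>Q\<close>.
\<close>

text \<open>Existence of a value is the hypothesis; uniqueness holds because \<open>FinSet\<close>
  and \<open>fset\<close> are injective, so the union determines the image vertex.\<close>

lemma clique_map_is_function:
  assumes "co_surjective (clique_graph G) (clique_map G R)"
  shows "is_function (clique_graph G) (clique_map G R)"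
  unfolding is_function_def
proof
  fix x assume "x \<in> verts (clique_graph G)"
  then obtain y where y: "(y, x) \<in> clique_map G R"
    using assms unfolding co_surjective_def rel_at_def by blast
  have "z = y" if "(z, x) \<in> clique_map G R" for z
    using that y by (auto simp: clique_map_def fset_inject)
  with y have "rel_at (clique_map G R) x = {y}"
    unfolding rel_at_def by blast
  then show "is_singleton (rel_at (clique_map G R) x)"
    by simp
qed

lemma clique_map_in_catF:
  assumes "clique_map G R \<in> Hom catS (clique_graph G) (clique_graph H)"
  shows "clique_map G R \<in> Hom catF (clique_graph G) (clique_graph H)"
  using assms clique_map_is_function by (auto simp: catS_def catF_def)

text \<open>Both sides relate \<open>h\<close> to a clique \<open>K\<close> exactly when
  \<open>h\<close> lies in the union of the sets \<open>rel_at R g\<close> over \<open>g\<close> in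
  \<open>K\<close>.\<close>

lemma membership_natural:
  assumes "clique_map G R \<in> Hom catS (clique_graph G) (clique_graph H)"
  shows "R O membership G = membership H O clique_map G R"
proof (intro set_eqI iffI)
  fix p assume "p \<in> R O membership G"
  then obtain h g K where p: "p = (h, FinSet K)" and K: "is_clique G K" "g \<in> fset K" "(h, g) \<in> R"
    by (auto simp: membership_def)
  have "FinSet K \<in> verts (clique_graph G)"
    using K(1) by (simp add: clique_graph_def)
  \<comment> \<open>Co-surjectivity of the clique map guarantees that the union over
    \<open>K\<close> is represented by some \<open>fset\<close>.\<close>
  then obtain y where "(y, FinSet K) \<in> clique_map G R"
    using assms unfolding catS_def co_surjective_def rel_at_def by auto
  then obtain D where D: "(FinSet D, FinSet K) \<in> clique_map G R"
      "fset D = (\<Union>c\<in>fset K. rel_at R c)"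
    by (auto simp: clique_map_def)
  \<comment> \<open>That \<open>D\<close> is a clique of \<open>H\<close> is read off from the
    codomain of the clique map.\<close>
  have "FinSet D \<in> verts (clique_graph H)"
    using assms D(1) by (auto simp: catS_def)
  then have "is_clique H D"
    by (simp add: clique_graph_def)
  moreover have "h \<in> fset D"
    using D(2) K by (auto simp: rel_at_def)
  ultimately show "p \<in> membership H O clique_map G R"
    using D(1) p by (auto simp: membership_def)
next
  fix p assume "p \<in> membership H O clique_map G R"
  then obtain h K D where p: "p = (h, FinSet K)" and K: "is_clique G K"
      and "h \<in> fset D" "fset D = (\<Union>c\<in>fset K. rel_at R c)"
    by (auto simp: membership_def clique_map_def)
  then obtain g where "g \<in> fset K" "(h, g) \<in> R"
    by (auto simp: rel_at_def)
  then show "p \<in> R O membership G"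
    using p K by (auto simp: membership_def)
qed

theorem corollary4p39:
  fixes C :: "'a univ cat"
  assumes "subcategory C catS"
    and "clique_closed C"
    and "amalgamation (cat_inter C catF)"
  shows "amalgamation C"
  unfolding amalgamation_def
proof (intro ballI)
  fix G H I R Q
  assume obj: "G \<in> Obj C" "H \<in> Obj C" "I \<in> Obj C" and R: "R \<in> Hom C H G" and Q: "Q \<in> Hom C I G"
  have sub: "S \<in> Hom catS A B" if "S \<in> Hom C A B" for S A B
    using assms(1) that unfolding subcategory_def by blast
  have comp: "T O S \<in> Hom C A D" if "S \<in> Hom C A B" "T \<in> Hom C B D" for S T A B D
    using assms(1) that unfolding subcategory_def by blast
  have X_obj: "clique_graph A \<in> Obj (cat_inter C catF)"
    and mem: "membership A \<in> Hom C (clique_graph A) A" if "A \<in> Obj C" for A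
    using assms(1,2) that
    unfolding clique_closed_def subcategory_def cat_inter_def catF_def catS_def by auto
  have X_R: "clique_map H R \<in> Hom C (clique_graph H) (clique_graph G)"
    and X_Q: "clique_map I Q \<in> Hom C (clique_graph I) (clique_graph G)"
    using assms(2) obj R Q unfolding clique_closed_def by blast+
  have "clique_map H R \<in> Hom (cat_inter C catF) (clique_graph H) (clique_graph G)"
    "clique_map I Q \<in> Hom (cat_inter C catF) (clique_graph I) (clique_graph G)"
    using X_R X_Q X_R[THEN sub, THEN clique_map_in_catF] X_Q[THEN sub, THEN clique_map_in_catF]
    by (auto simp: cat_inter_def)
  then have "\<exists>J\<in>Obj (cat_inter C catF). \<exists>R'\<in>Hom (cat_inter C catF) J (clique_graph H).
      \<exists>Q'\<in>Hom (cat_inter C catF) J (clique_graph I). clique_map H R O R' = clique_map I Q O Q'"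
    using assms(3)[unfolded amalgamation_def, rule_format,
        OF X_obj[OF obj(1)] X_obj[OF obj(2)] X_obj[OF obj(3)]] by simp
  \<comment> \<open>The span is viewed in \<open>C\<close> again, as the membership relations it is
    composed with are in general not functions.\<close>
  then obtain J R' Q' where J: "J \<in> Obj C"
    and R': "R' \<in> Hom C J (clique_graph H)" and Q': "Q' \<in> Hom C J (clique_graph I)"
    and eq: "clique_map H R O R' = clique_map I Q O Q'"
    unfolding cat_inter_def by simp blast
  \<comment> \<open>Bracketing to the left exposes \<open>R O membership H\<close>, to which
    naturality applies; below, naturality for \<open>Q\<close> is used in the reverse
    direction.\<close>
  have "R O membership H O R' = membership G O clique_map H R O R'"
    by (simp add: membership_natural[OF sub[OF X_R]] flip: O_assoc)
  also have "\<dots> = Q O membership I O Q'"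
    by (simp add: eq membership_natural[OF sub[OF X_Q]] flip: O_assoc)
  finally show "\<exists>J\<in>Obj C. \<exists>R'\<in>Hom C J H. \<exists>Q'\<in>Hom C J I. R O R' = Q O Q'"
    using J comp[OF R' mem[OF obj(2)]] comp[OF Q' mem[OF obj(3)]] by blast
qed

end
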